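(* Let $p$ be a prime and let $\mathfrak d=(d_i)_{i\ge1}$ be a sequence of positive integers. For all integers $n\ge1$, $$\sup\{N^{\mathfrak d}_r(m,n): m\in\mathbb N,\ r\in\mathbb Z^+\}\le n\,4^n e^{2\pi n/\sqrt3}.$$ In particular, $\sup\{N(m,n): m\in\mathbb N\}$ is bounded exponentially by $n\,4^n e^{2\pi n/\sqrt3}$.
   Context: $\mathbb N=\{0,1,2,\dots\}$ and $\mathbb Z^+=\{1,2,\dots\}$. For $m,n\ge0$ and $r\ge1$, $N^{\mathfrak d}_r(m,n)$ is the number of pairs $(\mathfrak a,\mathfrak b')$ with $\mathfrak a=(a_1,\dots,a_r)\in\mathbb N^r$ and $\mathfrak b'=(b'_1,\dots,b'_r)$, $b'_i\in\{0,d_i\}$, satisfying $2\sum_{i=1}^r a_i+\sum_{j=1}^r b'_j=n$ and $b'_1+\sum_{i=1}^{r-1}(a_i+b'_{i+1})p^i+a_rp^r=m$. When $d_i=1$ for all $i$, write $N_r(m,n)$ for $N^{\mathfrak d}_r(m,n)$; it does not depend on $r$ once $p^r>m$, and $N(m,n)$ denotes this stable value. *)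

theory Defs
  imports
    Complex_Main
    "HOL-Library.FuncSet"
    "HOL-Library.Extended_Real"
    "HOL-Computational_Algebra.Primes"
begin

text \<open>
  Tuples indexed by \<open>{1..r}\<close> are extensional functions, so that each tuple is represented
  exactly once; the sequence \<open>d\<close> is indexed from 1 and \<open>d 0\<close> is never used.
\<close>

definition sols :: "nat \<Rightarrow> (nat \<Rightarrow> nat) \<Rightarrow> nat \<Rightarrow> nat \<Rightarrow> nat \<Rightarrow> ((nat \<Rightarrow> nat) \<times> (nat \<Rightarrow> nat)) set"
  where "sols p d r m n =
    {(a, b). a \<in> {1..r} \<rightarrow>\<^sub>E UNIV \<and> b \<in> (\<Pi>\<^sub>E i\<in>{1..r}. {0, d i}) \<and>
       2 * (\<Sum>i=1..r. a i) + (\<Sum>j=1..r. b j) = n \<and>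
       b 1 + (\<Sum>i=1..<r. (a i + b (i + 1)) * p ^ i) + a r * p ^ r = m}"

definition Nd :: "nat \<Rightarrow> (nat \<Rightarrow> nat) \<Rightarrow> nat \<Rightarrow> nat \<Rightarrow> nat \<Rightarrow> nat"
  where "Nd p d r m n = card (sols p d r m n)"

definition Nr :: "nat \<Rightarrow> nat \<Rightarrow> nat \<Rightarrow> nat \<Rightarrow> nat"
  where "Nr p r m n = Nd p (\<lambda>_. 1) r m n"

text \<open>The stable value; it is well defined for \<open>p \<ge> 2\<close> by \<open>Nstab_eq\<close> below.\<close>

definition Nstab :: "nat \<Rightarrow> nat \<Rightarrow> nat \<Rightarrow> nat"
  where "Nstab p m n = (THE v. \<forall>r\<ge>1. m < p ^ r \<longrightarrow> Nr p r m n = v)"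

text \<open>The counted sets are finite, so \<^const>\<open>card\<close> is a genuine count.\<close>

lemma finite_sols: "finite (sols p d r m n)"
proof (rule finite_subset)
  show "sols p d r m n \<subseteq> ({1..r} \<rightarrow>\<^sub>E {..n}) \<times> (\<Pi>\<^sub>E i\<in>{1..r}. {0, d i})"
  proof (clarsimp simp: sols_def PiE_iff)
    fix a b :: "nat \<Rightarrow> nat" and i
    assume "Suc 0 \<le> i" "i \<le> r"
    then have "a i \<le> (\<Sum>i=Suc 0..r. a i)" by (intro member_le_sum) auto
    then show "a i \<le> 2 * (\<Sum>i=Suc 0..r. a i) + (\<Sum>j=Suc 0..r. b j)" by simp
  qed
  show "finite (({1..r} \<rightarrow>\<^sub>E {..n}) \<times> (\<Pi>\<^sub>E i\<in>{1..r}. {0, d i}))"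
    by (intro finite_cartesian_product finite_PiE) auto
qed

lemma Nd_Suc:
  assumes r: "r \<ge> 1" and p: "p \<ge> 2" and m: "m < p ^ r"
  shows "Nd p d (Suc r) m n = Nd p d r m n"
proof -
  let ?f = "\<lambda>(a, b). (a(Suc r := 0 :: nat), b(Suc r := 0 :: nat))"
  let ?g = "\<lambda>(a :: nat \<Rightarrow> nat, b :: nat \<Rightarrow> nat). (a(Suc r := undefined), b(Suc r := undefined))"
  have m': "m < p ^ Suc r" using m p by (simp add: less_le_trans)
  have z: "x = 0" if "x * p ^ k \<le> m" "m < p ^ k" for x k
    using that by (cases x) auto
  have eq1: "(\<Sum>i=1..Suc r. c i) = (\<Sum>i=1..r. c i) + c (Suc r)" for c :: "nat \<Rightarrow> nat"
    by simp
  have eq2: "(\<Sum>i=1..<Suc r. c i) = (\<Sum>i=1..<r. c i) + c r" for c :: "nat \<Rightarrow> nat"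
    using r by simp
  have up: "?f x \<in> sols p d (Suc r) m n \<and> ?g (?f x) = x" if x: "x \<in> sols p d r m n" for x
  proof -
    obtain a b where xab: "x = (a, b)" by force
    have a: "a \<in> {1..r} \<rightarrow>\<^sub>E UNIV" and b: "b \<in> (\<Pi>\<^sub>E i\<in>{1..r}. {0, d i})"
      and e1: "2 * (\<Sum>i=1..r. a i) + (\<Sum>j=1..r. b j) = n"
      and e2: "b 1 + (\<Sum>i=1..<r. (a i + b (i + 1)) * p ^ i) + a r * p ^ r = m"
      using x by (auto simp: sols_def xab)
    have und: "a (Suc r) = undefined" "b (Suc r) = undefined"
      using a b by (auto simp: PiE_def extensional_def)
    have "(\<Sum>i=1..<r. ((a(Suc r := 0)) i + (b(Suc r := 0)) (i + 1)) * p ^ i)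
        = (\<Sum>i=1..<r. (a i + b (i + 1)) * p ^ i)"
      by (intro sum.cong) auto
    moreover have "(\<Sum>i=1..r. (a(Suc r := 0)) i) = (\<Sum>i=1..r. a i)"
      "(\<Sum>i=1..r. (b(Suc r := 0)) i) = (\<Sum>i=1..r. b i)"
      by (intro sum.cong; auto)+
    ultimately have "?f x \<in> sols p d (Suc r) m n"
      using a b e1 e2 r unfolding sols_def xab prod.case mem_Collect_eq eq1 eq2
      by (auto simp: PiE_iff extensional_def)
    then show ?thesis using und by (auto simp: xab)
  qed
  have down: "?g x \<in> sols p d r m n \<and> ?f (?g x) = x" if x: "x \<in> sols p d (Suc r) m n" for x
  proof -
    obtain a b where xab: "x = (a, b)" by force
    have a: "a \<in> {1..Suc r} \<rightarrow>\<^sub>E UNIV" and b: "b \<in> (\<Pi>\<^sub>E i\<in>{1..Suc r}. {0, d i})"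
      and e1: "2 * ((\<Sum>i=1..r. a i) + a (Suc r)) + ((\<Sum>j=1..r. b j) + b (Suc r)) = n"
      and e2: "b 1 + ((\<Sum>i=1..<r. (a i + b (i + 1)) * p ^ i) + (a r + b (r + 1)) * p ^ r)
                 + a (Suc r) * p ^ Suc r = m"
      using x unfolding sols_def xab prod.case mem_Collect_eq eq1 eq2 by blast+
    have "a (Suc r) * p ^ Suc r \<le> m" using e2 by linarith
    then have a0: "a (Suc r) = 0" using z m' by blast
    have "b (Suc r) * p ^ r \<le> m" using e2 by (simp add: distrib_right)
    then have b0: "b (Suc r) = 0" using z m by blast
    have "(\<Sum>i=1..<r. ((a(Suc r := undefined)) i + (b(Suc r := undefined)) (i + 1)) * p ^ i)
        = (\<Sum>i=1..<r. (a i + b (i + 1)) * p ^ i)"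
      by (intro sum.cong) auto
    moreover have "(\<Sum>i=1..r. (a(Suc r := undefined)) i) = (\<Sum>i=1..r. a i)"
      "(\<Sum>i=1..r. (b(Suc r := undefined)) i) = (\<Sum>i=1..r. b i)"
      by (intro sum.cong; auto)+
    ultimately have "?g x \<in> sols p d r m n"
      using a b e1 e2 r a0 b0 unfolding sols_def xab prod.case mem_Collect_eq
      by (auto simp: PiE_iff extensional_def)
    then show ?thesis using a0 b0 by (auto simp: xab fun_upd_idem)
  qed
  have "bij_betw ?f (sols p d r m n) (sols p d (Suc r) m n)"
    using up down by (intro bij_betw_byWitness[where f' = ?g]) blast+
  then show ?thesis by (simp add: Nd_def bij_betw_same_card)
qed

lemma Nr_mono_eq:
  assumes "r \<le> s" "r \<ge> 1" "p \<ge> 2" "m < p ^ r"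
  shows "Nr p s m n = Nr p r m n"
  using assms(1)
proof (induction s rule: dec_induct)
  case (step s)
  have "p ^ r \<le> p ^ s" using step assms by (intro power_increasing) auto
  then have "m < p ^ s" using assms by linarith
  then have "Nr p (Suc s) m n = Nr p s m n"
    using step assms unfolding Nr_def by (intro Nd_Suc) auto
  with step show ?case by simp
qed simp

lemma Nstab_eq:
  assumes r: "r \<ge> 1" and p: "p \<ge> 2" and m: "m < p ^ r"
  shows "Nstab p m n = Nr p r m n"
  unfolding Nstab_def
proof (rule the_equality)
  show "\<forall>s\<ge>1. m < p ^ s \<longrightarrow> Nr p s m n = Nr p r m n"
  proof (intro allI impI)
    fix s :: nat assume s: "1 \<le> s" "m < p ^ s"
    show "Nr p s m n = Nr p r m n"
      using Nr_mono_eq[of r s p m n] Nr_mono_eq[of s r p m n] s r p m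
      by (cases "r \<le> s") auto
  qed
qed (use r m in auto)

end

theory Submission
  imports Defs
begin

text \<open>
  Put \<open>c\<^sub>0 = b'\<^sub>1\<close>, \<open>c\<^sub>i = a\<^sub>i + b'\<^sub>i\<^sub>+\<^sub>1\<close> for \<open>0 < i < r\<close> and \<open>c\<^sub>r = a\<^sub>r\<close>. Then \<open>m = \<Sum>\<^sub>i c\<^sub>i p\<^sup>i\<close> with
  \<open>\<Sum>\<^sub>i c\<^sub>i \<le> n\<close>, and \<open>c\<close> together with the support of \<open>b'\<close> determines the solution. Since the
  support of \<open>c\<close> has at most \<open>n\<close> elements, each \<open>c\<close> comes from at most \<open>2\<^sup>n\<close> solutions.

  The sequences \<open>c\<close> are counted by choosing the coefficient of the highest power first: if the
  quotient of what remains by that power is \<open>q\<close>, there are \<open>q + 1\<close> choices, and a choice of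
  \<open>c \<le> q\<close> makes the next quotient at least \<open>2 (q - c)\<close>. Hence \<open>4\<^sup>s / 2\<^sup>q\<close> bounds the number of
  completions by at most \<open>s\<close> summands, because \<open>q + 1 \<le> 2\<^sup>q\<close>. Altogether there are at most
  \<open>8\<^sup>n\<close> solutions.
\<close>

definition power_reps :: "nat \<Rightarrow> nat \<Rightarrow> nat \<Rightarrow> nat \<Rightarrow> (nat \<Rightarrow> nat) set"
  where "power_reps p k s m =
    {c \<in> {..<k} \<rightarrow>\<^sub>E UNIV. (\<Sum>i<k. c i) \<le> s \<and> (\<Sum>i<k. c i * p ^ i) = m}"

lemma finite_power_reps: "finite (power_reps p k s m)"
proof (rule finite_subset)
  show "power_reps p k s m \<subseteq> {..<k} \<rightarrow>\<^sub>E {..s}"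
  proof
    fix c assume c: "c \<in> power_reps p k s m"
    have "c i \<le> s" if "i < k" for i
    proof -
      have "c i \<le> (\<Sum>i<k. c i)" using that by (intro member_le_sum) auto
      then show ?thesis using c by (simp add: power_reps_def)
    qed
    then show "c \<in> {..<k} \<rightarrow>\<^sub>E {..s}" using c by (auto simp: power_reps_def PiE_iff)
  qed
qed (auto intro: finite_PiE)

lemma power_reps_Suc_subset:
  assumes "p > 0"
  shows "power_reps p (Suc k) s m \<subseteq>
    (\<Union>x\<in>{x. x \<le> m div p ^ k \<and> x \<le> s}.
       (\<lambda>c. c(k := x)) ` power_reps p k (s - x) (m - x * p ^ k))"
proof
  fix c assume "c \<in> power_reps p (Suc k) s m"
  then have c: "c \<in> {..<Suc k} \<rightarrow>\<^sub>E UNIV" "(\<Sum>i<k. c i) + c k \<le> s"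
    "(\<Sum>i<k. c i * p ^ i) + c k * p ^ k = m"
    by (auto simp: power_reps_def)
  let ?c = "c(k := undefined)"
  have "(\<Sum>i<k. ?c i) = (\<Sum>i<k. c i)" "(\<Sum>i<k. ?c i * p ^ i) = (\<Sum>i<k. c i * p ^ i)"
    by (intro sum.cong; simp)+
  then have "?c \<in> power_reps p k (s - c k) (m - c k * p ^ k)"
    using c by (auto simp: power_reps_def PiE_iff extensional_def)
  moreover have "c k \<le> m div p ^ k"
    using c(3) assms by (metis le_add2 less_eq_div_iff_mult_less_eq zero_less_power)
  moreover have "c k \<le> s" using c(2) by linarith
  moreover have "c = ?c(k := c k)" by simp
  ultimately show "c \<in> (\<Union>x\<in>{x. x \<le> m div p ^ k \<and> x \<le> s}.
       (\<lambda>c. c(k := x)) ` power_reps p k (s - x) (m - x * p ^ k))"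
    by blast
qed

text \<open>The exponent is the quotient of \<open>m\<close> by the highest available power \<open>p\<^sup>k\<^sup>-\<^sup>1\<close>, written so that
  \<open>k = 0\<close> is allowed.\<close>

lemma card_power_reps:
  assumes p: "p \<ge> 2"
  shows "card (power_reps p k s m) * 2 ^ (m * p div p ^ k) \<le> 4 ^ s"
proof (induction k arbitrary: s m)
  case 0
  \<comment> \<open>With no power available only \<open>m = 0\<close> is representable, and there
    the exponent vanishes.\<close>
  have "power_reps p 0 s m = (if m = 0 then {\<lambda>_. undefined} else {})"
    by (auto simp: power_reps_def)
  then show ?case by simp
next
  case (Suc k)
  define q where "q = m div p ^ k"
  let ?X = "{x. x \<le> q \<and> x \<le> s}"
  have finX: "finite ?X" by simp
  \<comment> \<open>Spending \<open>x\<close> summands costs a factor \<open>4 ^ x\<close> on both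
    sides, so all branches meet the same bound.\<close>
  have branch: "card (power_reps p k (s - x) (m - x * p ^ k)) * 4 ^ q \<le> 4 ^ s"
    if x: "x \<in> ?X" for x
  proof -
    let ?N = "card (power_reps p k (s - x) (m - x * p ^ k))"
    have "(q - x) * p ^ k \<le> m - x * p ^ k"
      by (simp add: q_def diff_mult_distrib diff_le_mono)
    \<comment> \<open>Measured in the next lower power, the remainder is at least
      \<open>p \<ge> 2\<close> times \<open>q - x\<close>; this squares the base 2 to 4.\<close>
    from mult_le_mono[OF this p] have "(2 * (q - x)) * p ^ k \<le> (m - x * p ^ k) * p"
      by (simp add: mult_ac)
    then have "2 * (q - x) \<le> (m - x * p ^ k) * p div p ^ k"
      using p by (simp add: less_eq_div_iff_mult_less_eq)
    then have "(2::nat) ^ (2 * (q - x)) \<le> 2 ^ ((m - x * p ^ k) * p div p ^ k)"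
      by (intro power_increasing) auto
    then have "?N * 4 ^ (q - x) \<le> 4 ^ (s - x)"
      using Suc.IH[of "s - x" "m - x * p ^ k"]
      by (simp add: power_mult) (meson le_trans mult_le_mono2)
    then have "?N * 4 ^ (q - x) * 4 ^ x \<le> 4 ^ (s - x) * 4 ^ x" by simp
    then show ?thesis using x by (simp add: mult.assoc flip: power_add)
  qed
  have "card (power_reps p (Suc k) s m)
      \<le> card (\<Union>x\<in>?X. (\<lambda>c. c(k := x)) ` power_reps p k (s - x) (m - x * p ^ k))"
    using power_reps_Suc_subset[of p k s m] p finX
    by (intro card_mono) (auto simp: q_def finite_power_reps)
  also have "\<dots> \<le> (\<Sum>x\<in>?X. card ((\<lambda>c. c(k := x)) ` power_reps p k (s - x) (m - x * p ^ k)))"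
    by (rule card_UN_le[OF finX])
  also have "\<dots> \<le> (\<Sum>x\<in>?X. card (power_reps p k (s - x) (m - x * p ^ k)))"
    by (intro sum_mono card_image_le finite_power_reps)
  finally have "card (power_reps p (Suc k) s m) * 4 ^ q
      \<le> (\<Sum>x\<in>?X. card (power_reps p k (s - x) (m - x * p ^ k)) * 4 ^ q)"
    by (simp flip: sum_distrib_right)
  also have "\<dots> \<le> card ?X * 4 ^ s"
    using sum_bounded_above[OF branch, of ?X] by simp
  also have "card ?X \<le> Suc q"
    using card_mono[of "{..q}" ?X] by auto
  \<comment> \<open>One of the two copies of \<open>2 ^ q\<close> in \<open>4 ^ q\<close> pays for
    the choices of \<open>x\<close>; the other stays as the weight.\<close>
  also have "Suc q \<le> 2 ^ q"
    by (simp add: Suc_leI less_exp)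
  finally have "card (power_reps p (Suc k) s m) * 4 ^ q \<le> 2 ^ q * 4 ^ s" by simp
  moreover have "(4::nat) ^ q = 2 ^ q * 2 ^ q" by (simp flip: power_mult_distrib)
  ultimately have "2 ^ q * (card (power_reps p (Suc k) s m) * 2 ^ q) \<le> 2 ^ q * 4 ^ s"
    by (simp only: mult_ac)
  then have "card (power_reps p (Suc k) s m) * 2 ^ q \<le> 4 ^ s"
    by (rule mult_left_le_imp_le) simp
  moreover have "m * p div p ^ Suc k = q" using p by (simp add: q_def mult.commute)
  ultimately show ?case by simp
qed

lemma card_support_le_sum:
  fixes c :: "'a \<Rightarrow> nat"
  assumes "finite A"
  shows "card {i \<in> A. c i \<noteq> 0} \<le> sum c A"
proof -
  have "card {i \<in> A. c i \<noteq> 0} = (\<Sum>i\<in>{i \<in> A. c i \<noteq> 0}. 1)" by simp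
  also have "\<dots> \<le> (\<Sum>i\<in>{i \<in> A. c i \<noteq> 0}. c i)" by (intro sum_mono) auto
  also have "\<dots> \<le> sum c A" using assms by (intro sum_mono2) auto
  finally show ?thesis .
qed

lemma Nd_le:
  assumes p: "p \<ge> 2" and r: "r \<ge> 1"
  shows "Nd p d r m n \<le> 8 ^ n"
proof -
  define C :: "(nat \<Rightarrow> nat) \<Rightarrow> (nat \<Rightarrow> nat) \<Rightarrow> nat \<Rightarrow> nat" where
    "C a b = (\<lambda>i\<in>{..<Suc r}. (if i = 0 then 0 else a i) + (if i < r then b (Suc i) else 0))" for a b
  let ?supp = "\<lambda>c :: nat \<Rightarrow> nat. {i \<in> {..<Suc r}. c i \<noteq> 0}"
  let ?F = "\<lambda>(a, b). (C a b, {i \<in> {..<r}. b (Suc i) \<noteq> 0})"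
  let ?R = "power_reps p (Suc r) n m"
  have C_reps: "C a b \<in> ?R" if "(a, b) \<in> sols p d r m n" for a b
  proof -
    have e1: "2 * (\<Sum>i=1..r. a i) + (\<Sum>j=1..r. b j) = n"
      and e2: "b 1 + (\<Sum>i=1..<r. (a i + b (i + 1)) * p ^ i) + a r * p ^ r = m"
      using that by (auto simp: sols_def)
    have split: "(\<Sum>i<Suc r. f i) = f 0 + (\<Sum>i=1..<r. f i) + f r" for f :: "nat \<Rightarrow> nat"
      using r by (simp add: lessThan_atLeast0 sum.atLeast_Suc_lessThan)
    have "(\<Sum>i<Suc r. C a b i) = b 1 + (\<Sum>i=1..<r. a i + b (Suc i)) + a r"
      unfolding split using r by (auto simp: C_def intro!: sum.cong)
    also have "\<dots> = ((\<Sum>i=1..<r. a i) + a r) + (b 1 + (\<Sum>i=1..<r. b (Suc i)))"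
      by (simp add: sum.distrib)
    also have "(\<Sum>i=1..<r. a i) + a r = (\<Sum>i=1..r. a i)"
      using r by (metis sum.last_plus add.commute)
    also have "b 1 + (\<Sum>i=1..<r. b (Suc i)) = (\<Sum>i=1..r. b i)"
      using r sum.shift_bounds_Suc_ivl[of b 1 r]
      by (simp add: sum.atLeast_Suc_atMost atLeastLessThanSuc_atLeastAtMost)
    \<comment> \<open>The coefficients add up to the sum of \<open>a\<close> plus that of
      \<open>b\<close>, whereas \<open>n\<close> counts the former twice.\<close>
    finally have "(\<Sum>i<Suc r. C a b i) \<le> n" using e1 by linarith
    moreover have "(\<Sum>i<Suc r. C a b i * p ^ i) = m"
      unfolding split e2[symmetric] using r by (auto simp: C_def intro!: sum.cong)
    ultimately show ?thesis by (simp add: power_reps_def C_def)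
  qed
  have "inj_on ?F (sols p d r m n)"
  proof (rule inj_onI, clarify)
    fix a b a' b'
    assume s: "(a, b) \<in> sols p d r m n" "(a', b') \<in> sols p d r m n"
      and C: "C a b = C a' b'"
      and S: "{i \<in> {..<r}. b (Suc i) \<noteq> 0} = {i \<in> {..<r}. b' (Suc i) \<noteq> 0}"
    have a: "a \<in> {1..r} \<rightarrow>\<^sub>E UNIV" "a' \<in> {1..r} \<rightarrow>\<^sub>E UNIV"
      and b: "b \<in> (\<Pi>\<^sub>E i\<in>{1..r}. {0, d i})" "b' \<in> (\<Pi>\<^sub>E i\<in>{1..r}. {0, d i})"
      using s by (auto simp: sols_def)
    \<comment> \<open>Only 0 and \<open>d i\<close> are possible, so knowing whether
      \<open>b i\<close> vanishes recovers it.\<close>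
    have bb: "b i = b' i" if i: "i \<in> {1..r}" for i
    proof -
      obtain j where j: "i = Suc j" "j < r" using i by (cases i) auto
      have "b i \<noteq> 0 \<longleftrightarrow> b' i \<noteq> 0" using S j by blast
      moreover have "b i \<in> {0, d i}" "b' i \<in> {0, d i}" using b i by (auto simp: PiE_iff)
      ultimately show ?thesis by auto
    qed
    have aa: "a i = a' i" if i: "i \<in> {1..r}" for i
    proof -
      have "C a b i = C a' b' i" using C by simp
      then show ?thesis using i bb[of "Suc i"] by (auto simp: C_def split: if_splits)
    qed
    show "a = a' \<and> b = b'"
      using PiE_ext[OF a aa] PiE_ext[OF b bb] by blast
  qed
  \<comment> \<open>Natural numbers cannot cancel: a nonzero \<open>b (Suc i)\<close> makes the
    coefficient at \<open>i\<close> nonzero.\<close>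
  moreover have "?F ` sols p d r m n \<subseteq> (SIGMA c:?R. Pow (?supp c))"
    using C_reps by (auto simp: C_def)
  moreover have "finite (SIGMA c:?R. Pow (?supp c))"
    by (intro finite_SigmaI finite_power_reps) auto
  ultimately have "Nd p d r m n \<le> card (SIGMA c:?R. Pow (?supp c))"
    unfolding Nd_def by (rule card_inj_on_le)
  also have "\<dots> = (\<Sum>c\<in>?R. 2 ^ card (?supp c))"
    by (subst card_SigmaI) (auto simp: finite_power_reps card_Pow)
  also have "\<dots> \<le> (\<Sum>c\<in>?R. 2 ^ n)"
  proof (intro sum_mono power_increasing)
    fix c assume "c \<in> ?R"
    then show "card (?supp c) \<le> n"
      using card_support_le_sum[of "{..<Suc r}" c] unfolding power_reps_def by fastforce
  qed simp
  also have "\<dots> = card ?R * 2 ^ n" by simp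
  also have "card ?R \<le> 4 ^ n"
  proof -
    have "card ?R * 1 \<le> card ?R * 2 ^ (m * p div p ^ Suc r)" by (intro mult_le_mono) auto
    then show ?thesis using card_power_reps[OF p, of "Suc r" n m] by linarith
  qed
  also have "(4::nat) ^ n * 2 ^ n = 8 ^ n" by (simp flip: power_mult_distrib)
  finally show ?thesis by simp
qed

text \<open>In \<open>8 ^ n = 4 ^ n * 2 ^ n\<close> this absorbs \<open>2 ^ n\<close> into the
  exponential. The exponent is at least 1, and \<open>exp x \<ge> 1 + x\<close>.\<close>

lemma two_le_exp: "2 \<le> exp (2 * pi / sqrt 3)"
proof -
  have "sqrt 3 \<le> 2" by (rule real_le_lsqrt) auto
  then have "1 \<le> 2 * pi / sqrt 3" using pi_ge_two by (simp add: le_divide_eq)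
  then show ?thesis using exp_ge_add_one_self[of "2 * pi / sqrt 3"] by linarith
qed

theorem proposition3p13:
  fixes p n :: nat and d :: "nat \<Rightarrow> nat"
  assumes "prime p"
    and "\<And>i. i \<ge> 1 \<Longrightarrow> d i > 0"
    and "n \<ge> 1"
  shows "Sup {ereal (real (Nd p d r m n)) | m r. r \<ge> 1}
           \<le> ereal (real n * 4 ^ n * exp (2 * pi * real n / sqrt 3)) \<and>
         Sup {ereal (real (Nstab p m n)) | m. True}
           \<le> ereal (real n * 4 ^ n * exp (2 * pi * real n / sqrt 3))"
proof -
  have p: "p \<ge> 2" using assms(1) by (rule prime_ge_2_nat)
  have "(8::real) ^ n = 4 ^ n * 2 ^ n" by (simp flip: power_mult_distrib)
  also have "\<dots> \<le> 4 ^ n * exp (2 * pi / sqrt 3) ^ n"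
    by (intro mult_left_mono power_mono two_le_exp) auto
  also have "exp (2 * pi / sqrt 3) ^ n = exp (2 * pi * real n / sqrt 3)"
    by (simp add: mult_ac flip: exp_of_nat_mult)
  also have "4 ^ n * exp (2 * pi * real n / sqrt 3)
      \<le> real n * (4 ^ n * exp (2 * pi * real n / sqrt 3))"
    using assms(3) mult_right_mono[of 1 "real n" "4 ^ n * exp (2 * pi * real n / sqrt 3)"] by simp
  finally have eight: "8 ^ n \<le> real n * 4 ^ n * exp (2 * pi * real n / sqrt 3)"
    by (simp add: mult.assoc)
  \<comment> \<open>A general sequence \<open>e\<close> covers both \<open>d\<close> and the
    constant 1 behind \<open>Nstab\<close>.\<close>
  have Nd: "real (Nd p e r m n) \<le> real n * 4 ^ n * exp (2 * pi * real n / sqrt 3)"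
    if "r \<ge> 1" for e r m
  proof -
    have "real (Nd p e r m n) \<le> 8 ^ n" using Nd_le[OF p that] by simp
    then show ?thesis using eight by (rule order_trans)
  qed
  have Nstab: "real (Nstab p m n) \<le> real n * 4 ^ n * exp (2 * pi * real n / sqrt 3)" for m
  proof -
    \<comment> \<open>The index \<open>m + 1\<close> is already stable, as
      \<open>m < 2 ^ (m + 1)\<close>, and it is positive even for \<open>m = 0\<close>.\<close>
    have "m < p ^ Suc m"
      using less_exp[of "Suc m"] power_mono[OF p, of "Suc m"] by linarith
    then have "Nstab p m n = Nd p (\<lambda>_. 1) (Suc m) m n"
      using p by (simp add: Nstab_eq[of "Suc m"] Nr_def)
    then show ?thesis using Nd by simp
  qed
  show ?thesis using Nd Nstab by (auto intro!: Sup_least)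
qed

end
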